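(* Let $A$ be a finite cyclic group, let $B$ be a group, and let $G=A\wr B$ be their wreath product. Then the Schreier digraph of the right action of $G$ on the homogeneous space $A\backslash G\cong B^{|A|}$, given in terms of $B^{|A|}$ by $$ \boldsymbol b.(a,\Phi)=\mathbf T^{-a}(\boldsymbol b\cdot\Phi),\qquad \boldsymbol b\in B^{|A|},\ (a,\Phi)\in G, $$ with respect to the set $\widetilde B_+=\{(1,\delta_1^b)\}_{b\in B}\subset G$, is isomorphic to the de Bruijn digraph $\overrightarrow{\mathcal B}_B^{|A|}$ of span $|A|$ over the alphabet $B$.
   Context: The group $A\cong\mathbb Z_n$, $n=|A|$, is written additively, with distinguished generator $1$. $B$ is a group with identity $e$, written multiplicatively. Let $\mathrm{fun}(A,B)$ be the group of all functions (configurations) $\Phi:A\to B$ with pointwise multiplication (as $A$ is finite, every configuration is finitely supported). The group $A$ acts on it by automorphisms $(\mathbf T^a\Phi)(x)=\Phi(x-a)$. The wreath product $G=A\wr B$ is the set $A\times\mathrm{fun}(A,B)$ with multiplication $$(a_1,\Phi_1)\cdot(a_2,\Phi_2)=(a_1+a_2,\ \Phi_1\cdot\mathbf T^{a_1}\Phi_2).$$ For $a\in A$, $b\in B$ the configuration $\delta_a^b$ takes the value $b$ at $a$ and $e$ elsewhere. Let $\varnothing$ be the configuration identically equal to $e$. The group $A$ is embedded in $G$ as the subgroup $\{(a,\varnothing):a\in A\}$. The space of cosets $A\backslash G=\{Ag: g\in G\}$ is identified with $\mathrm{fun}(A,B)$ by the map induced by $(a,\Phi)\mapsto\mathbf T^{-a}\Phi$.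 Further, $\mathrm{fun}(A,B)$ is identified with $B^n$ by associating with a configuration $\Psi$ the word $\beta_1\beta_2\dots\beta_n$, $\beta_i=\Psi(i \bmod n)$. Under these identifications the natural right action of $G$ on $A\backslash G$ takes the form displayed in the claim. Given a right action of a group $G$ on a set $X$ and a subset $K\subset G$, the Schreier digraph has vertex set $X$ and arrows $x\to xk$, $x\in X$, $k\in K$. The de Bruijn digraph $\overrightarrow{\mathcal B}_B^{n}$ of span $n$ over an alphabet $B$ (not necessarily finite) has vertex set $B^n$ and arrows $\alpha_1\alpha_2\dots\alpha_n\to\alpha_2\dots\alpha_n\alpha_{n+1}$ for all $\alpha_1,\dots,\alpha_{n+1}\in B$. *)

theory Defs
  imports
    "HOL-Algebra.Elementary_Groups"
    "HOL-Algebra.Product_Groups"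
    "Graph_Theory.Digraph_Isomorphism"
begin

text \<open>
  All groups are in the multiplicative notation of HOL-Algebra, including the cyclic group that
  is customarily written additively: \<open>a\<^sub>1 + a\<^sub>2\<close> is \<open>a\<^sub>1 \<otimes> a\<^sub>2\<close> and \<open>- a\<close> is \<open>inv a\<close>.
  Configurations are extensional functions on \<open>carrier A\<close>, so that equal configurations are
  equal as HOL functions.
\<close>

abbreviation fun_group :: "('a, 'm) monoid_scheme \<Rightarrow> ('b, 'n) monoid_scheme \<Rightarrow> ('a \<Rightarrow> 'b) monoid"
  where "fun_group A B \<equiv> product_group (carrier A) (\<lambda>_. B)"

definition translate :: "('a, 'm) monoid_scheme \<Rightarrow> 'a \<Rightarrow> ('a \<Rightarrow> 'b) \<Rightarrow> 'a \<Rightarrow> 'b"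
  where "translate A a \<Phi> = (\<lambda>x\<in>carrier A. \<Phi> (x \<otimes>\<^bsub>A\<^esub> inv\<^bsub>A\<^esub> a))"

text \<open>
  Only for a finite \<open>A\<close> is this the (restricted) wreath product; for an infinite \<open>A\<close> there is
  no restriction to finitely supported configurations.
\<close>
definition wreath_product ::
  "('a, 'm) monoid_scheme \<Rightarrow> ('b, 'n) monoid_scheme \<Rightarrow> ('a \<times> ('a \<Rightarrow> 'b)) monoid"
  where "wreath_product A B =
    \<lparr>carrier = carrier A \<times> carrier (fun_group A B),
     monoid.mult = (\<lambda>(a\<^sub>1, \<Phi>\<^sub>1) (a\<^sub>2, \<Phi>\<^sub>2).
       (a\<^sub>1 \<otimes>\<^bsub>A\<^esub> a\<^sub>2, \<Phi>\<^sub>1 \<otimes>\<^bsub>fun_group A B\<^esub> translate A a\<^sub>1 \<Phi>\<^sub>2)),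
     one = (\<one>\<^bsub>A\<^esub>, \<one>\<^bsub>fun_group A B\<^esub>)\<rparr>"

definition delta :: "('a, 'm) monoid_scheme \<Rightarrow> ('b, 'n) monoid_scheme \<Rightarrow> 'a \<Rightarrow> 'b \<Rightarrow> 'a \<Rightarrow> 'b"
  where "delta A B a b = (\<lambda>x\<in>carrier A. if x = a then b else \<one>\<^bsub>B\<^esub>)"

definition embedded_active ::
  "('a, 'm) monoid_scheme \<Rightarrow> ('b, 'n) monoid_scheme \<Rightarrow> ('a \<times> ('a \<Rightarrow> 'b)) set"
  where "embedded_active A B = {(a, \<one>\<^bsub>fun_group A B\<^esub>) | a. a \<in> carrier A}"

text \<open>The library's \<open>rcosets\<close> are the sets \<open>H #> g = {h \<otimes> g | h \<in> H}\<close>.\<close>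
definition coset_space ::
  "('a, 'm) monoid_scheme \<Rightarrow> ('b, 'n) monoid_scheme \<Rightarrow> ('a \<times> ('a \<Rightarrow> 'b)) set set"
  where "coset_space A B = rcosets\<^bsub>wreath_product A B\<^esub> (embedded_active A B)"

text \<open>
  The map on cosets induced by \<open>(a, \<Phi>) \<mapsto> T\<^sup>-\<^sup>a \<Phi>\<close>: the single value which this map takes on
  the elements of the coset.
\<close>
definition coset_config :: "('a, 'm) monoid_scheme \<Rightarrow> ('a \<times> ('a \<Rightarrow> 'b)) set \<Rightarrow> 'a \<Rightarrow> 'b"
  where "coset_config A C = the_elem ((\<lambda>(a, \<Phi>). translate A (inv\<^bsub>A\<^esub> a) \<Phi>) ` C)"

definition config_action ::
  "('a, 'm) monoid_scheme \<Rightarrow> ('b, 'n) monoid_scheme \<Rightarrow>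
     ('a \<Rightarrow> 'b) \<Rightarrow> 'a \<times> ('a \<Rightarrow> 'b) \<Rightarrow> 'a \<Rightarrow> 'b"
  where "config_action A B \<Psi> = (\<lambda>(a, \<Phi>). translate A (inv\<^bsub>A\<^esub> a) (\<Psi> \<otimes>\<^bsub>fun_group A B\<^esub> \<Phi>))"

definition words :: "nat \<Rightarrow> 'b set \<Rightarrow> 'b list set"
  where "words n S = {w. length w = n \<and> set w \<subseteq> S}"

text \<open>
  The word \<open>\<beta>\<^sub>1 \<dots> \<beta>\<^sub>n\<close> of a configuration, \<open>\<beta>\<^sub>i\<close> being its value at the \<open>i\<close>-th multiple of the
  distinguished generator \<open>g\<close>.  In particular the last letter is the value at the identity.
\<close>
definition config_word :: "('a, 'm) monoid_scheme \<Rightarrow> 'a \<Rightarrow> ('a \<Rightarrow> 'b) \<Rightarrow> 'b list"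
  where "config_word A g \<Psi> = map (\<lambda>i. \<Psi> (g [^]\<^bsub>A\<^esub> i)) [1..<order A + 1]"

text \<open>The library's locale \<open>group_action\<close> is about left actions.\<close>
locale right_group_action = group G for G (structure) +
  fixes X :: "'x set" and act :: "'x \<Rightarrow> 'a \<Rightarrow> 'x"
  assumes act_closed: "\<lbrakk>x \<in> X; g \<in> carrier G\<rbrakk> \<Longrightarrow> act x g \<in> X"
    and act_one: "x \<in> X \<Longrightarrow> act x \<one> = x"
    and act_mult: "\<lbrakk>x \<in> X; g \<in> carrier G; h \<in> carrier G\<rbrakk> \<Longrightarrow> act x (g \<otimes> h) = act (act x g) h"

text \<open>There is one arrow for each pair \<open>(x, k)\<close>; parallel arrows are not merged.\<close>
definition schreier_digraph ::
  "'x set \<Rightarrow> ('x \<Rightarrow> 'g \<Rightarrow> 'x) \<Rightarrow> 'g set \<Rightarrow> ('x, 'x \<times> 'g) pre_digraph"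
  where "schreier_digraph X act K =
    \<lparr>verts = X, arcs = X \<times> K, tail = fst, head = (\<lambda>(x, k). act x k)\<rparr>"

text \<open>The arrow \<open>\<alpha>\<^sub>1 \<dots> \<alpha>\<^sub>n \<rightarrow> \<alpha>\<^sub>2 \<dots> \<alpha>\<^sub>n\<^sub>+\<^sub>1\<close> is represented by the word \<open>\<alpha>\<^sub>1 \<dots> \<alpha>\<^sub>n\<^sub>+\<^sub>1\<close>.\<close>
definition de_bruijn_digraph :: "nat \<Rightarrow> 'b set \<Rightarrow> ('b list, 'b list) pre_digraph"
  where "de_bruijn_digraph n S =
    \<lparr>verts = words n S, arcs = words (n + 1) S, tail = butlast, head = tl\<rparr>"

definition B_plus ::
  "('a, 'm) monoid_scheme \<Rightarrow> ('b, 'n) monoid_scheme \<Rightarrow> 'a \<Rightarrow> ('a \<times> ('a \<Rightarrow> 'b)) set"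
  where "B_plus A B g = {(g, delta A B g b) | b. b \<in> carrier B}"

end

theory Submission
  imports Defs "HOL-Algebra.Multiplicative_Group"
begin

text \<open>
  Every coset of \<open>A\<close> in \<open>A \<wr> B\<close> has exactly one representative with trivial \<open>A\<close>-component, since
  \<open>(a, \<Phi>) = (a, \<emptyset>) \<cdot> (1, T\<^sup>-\<^sup>a \<Phi>)\<close>.  This representative is the configuration attached to the coset,
  and \<open>(1, \<Psi>) \<cdot> (a, \<Phi>) = (a, \<Psi> \<cdot> \<Phi>)\<close> lies in the coset of \<open>(1, T\<^sup>-\<^sup>a (\<Psi> \<cdot> \<Phi>))\<close>; so right
  multiplication of cosets becomes the displayed action (lemmas \<open>rcosets_trivial_rep\<close>,
  \<open>coset_config_rcoset\<close> and \<open>coset_config_equivariant\<close>).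

  A configuration is read as the word of its values at \<open>g, g\<^sup>2, \<dots>, g\<^sup>n = 1\<close>, which is a bijective
  encoding because \<open>g\<close> generates a group of order \<open>n\<close>.  Acting by \<open>(g, \<delta>\<^sub>g\<^sup>b)\<close> multiplies
  the first letter \<open>\<beta>\<^sub>1\<close> by \<open>b\<close> on the right and then rotates the word by one place:
  \<open>\<beta>\<^sub>1 \<beta>\<^sub>2 \<dots> \<beta>\<^sub>n\<close> goes to \<open>\<beta>\<^sub>2 \<dots> \<beta>\<^sub>n (\<beta>\<^sub>1 b)\<close> (lemma \<open>config_word_step\<close>).  This is a shift in which
  a new letter enters at the end, and as \<open>b\<close> runs through the group \<open>B\<close>, so does the new letter
  \<open>\<beta>\<^sub>1 b\<close>, each letter occurring once.  Hence the arrows \<open>(\<Psi>, (g, \<delta>\<^sub>g\<^sup>b))\<close> correspond bijectively to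
  the words \<open>\<beta>\<^sub>1 \<dots> \<beta>\<^sub>n (\<beta>\<^sub>1 b)\<close> of length \<open>n + 1\<close>, which are the arrows of the de Bruijn digraph;
  the lemma \<open>schreier_iso_de_bruijn\<close> isolates this criterion.
\<close>

section \<open>Right actions\<close>

lemma (in group) right_group_action_rcosets:
  assumes "subgroup H G"
  shows "right_group_action G (rcosets H) (\<lambda>C x. C #> x)"
proof -
  have H: "H \<subseteq> carrier G"
    using assms by (rule subgroup.subset)
  have sub: "C \<subseteq> carrier G" if "C \<in> rcosets H" for C
    using rcosets_part_G[OF assms] that by auto
  show ?thesis
  proof unfold_locales
    fix C x assume "C \<in> rcosets H" "x \<in> carrier G"
    then show "C #> x \<in> rcosets H"
      using H by (auto simp: RCOSETS_def coset_mult_assoc)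
  next
    fix C assume "C \<in> rcosets H"
    then show "C #> \<one> = C"
      using sub by (simp add: coset_mult_one)
  next
    fix C x y assume "C \<in> rcosets H" "x \<in> carrier G" "y \<in> carrier G"
    then show "C #> (x \<otimes> y) = C #> x #> y"
      using sub by (simp add: coset_mult_assoc)
  qed
qed

lemma (in right_group_action) right_group_action_transport:
  assumes f: "bij_betw f X Y"
    and equivariant: "\<And>x k. x \<in> X \<Longrightarrow> k \<in> carrier G \<Longrightarrow> f (act x k) = act' (f x) k"
  shows "right_group_action G Y act'"
proof -
  have Y: "Y = f ` X"
    using f by (simp add: bij_betw_def)
  show ?thesis
    by unfold_locales
      (auto simp: Y equivariant[symmetric] act_closed act_one act_mult)
qed

section \<open>Words and de Bruijn digraphs\<close>

lemma bij_betw_PiE_words: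
  assumes h: "bij_betw h {1..<n + 1} I"
  shows "bij_betw (\<lambda>\<Psi>. map (\<lambda>i. \<Psi> (h i)) [1..<n + 1]) (I \<rightarrow>\<^sub>E S) (words n S)"
proof (rule bij_betwI)
  define k where "k = the_inv_into {1..<n + 1} h"
  have kh: "k (h i) = i" if "i \<in> {1..<n + 1}" for i
    unfolding k_def using h that by (simp add: bij_betw_def the_inv_into_f_f)
  have hk: "h (k x) = x" if "x \<in> I" for x
    unfolding k_def using h that by (simp add: bij_betw_def f_the_inv_into_f)
  have k: "k x \<in> {1..<n + 1}" if "x \<in> I" for x
    using bij_betw_the_inv_into[OF h] that unfolding k_def by (rule bij_betwE[rule_format])
  have hI: "h i \<in> I" if "i \<in> {1..<n + 1}" for i
    using h that by (auto simp: bij_betw_def)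
  let ?word = "\<lambda>\<Psi>. map (\<lambda>i. \<Psi> (h i)) [1..<n + 1]"
  let ?config = "\<lambda>w. \<lambda>x\<in>I. w ! (k x - 1)"
  show "?word \<in> (I \<rightarrow>\<^sub>E S) \<rightarrow> words n S"
    using hI by (auto simp: words_def PiE_iff)
  show "?config \<in> words n S \<rightarrow> (I \<rightarrow>\<^sub>E S)"
  proof
    fix w assume w: "w \<in> words n S"
    have "w ! (k x - 1) \<in> S" if "x \<in> I" for x
    proof -
      have "k x - 1 < length w"
        using k[OF that] w by (auto simp: words_def)
      then show ?thesis
        using w nth_mem unfolding words_def by blast
    qed
    then show "?config w \<in> I \<rightarrow>\<^sub>E S"
      by simp
  qed
  show "?config (?word \<Psi>) = \<Psi>" if "\<Psi> \<in> I \<rightarrow>\<^sub>E S" for \<Psi>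
  proof (rule PiE_ext[OF _ that])
    show "?config (?word \<Psi>) \<in> I \<rightarrow>\<^sub>E S"
      using \<open>?config \<in> _\<close> \<open>?word \<in> _\<close> that by blast
    show "?config (?word \<Psi>) x = \<Psi> x" if "x \<in> I" for x
    proof -
      have "[1..<n + 1] ! (k x - 1) = k x"
        using k[OF that] by (subst nth_upt) auto
      then show ?thesis
        using k[OF that] that by (subst restrict_apply', simp, subst nth_map) (auto simp: hk simp del: upt_Suc)
    qed
  qed
  show "?word (?config w) = w" if "w \<in> words n S" for w
  proof (rule nth_equalityI)
    show "length (?word (?config w)) = length w"
      using that by (simp add: words_def)
    fix j assume "j < length (?word (?config w))"
    then have j: "j < n"
      by (simp del: upt_Suc)
    then have "[1..<n + 1] ! j = Suc j"
      by (subst nth_upt) auto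
    then show "?word (?config w) ! j = w ! j"
      using j hI[of "Suc j"] kh[of "Suc j"] by (simp del: upt_Suc)
  qed
qed

lemma digraph_isoI:
  fixes H :: "('c, 'd) pre_digraph"
  assumes "wf_digraph G"
    and f: "bij_betw f (verts G) (verts H)"
    and h: "bij_betw h (arcs G) (arcs H)"
    and tl: "\<And>a. a \<in> arcs G \<Longrightarrow> tail H (h a) = f (tail G a)"
    and hd: "\<And>a. a \<in> arcs G \<Longrightarrow> head H (h a) = f (head G a)"
  shows "digraph_iso G H"
proof -
  let ?i = "\<lparr>iso_verts = f, iso_arcs = h, iso_head = head H, iso_tail = tail H\<rparr>"
  have "pre_digraph.digraph_isomorphism G ?i"
    using assms by (simp add: pre_digraph.digraph_isomorphism_def bij_betw_def)
  moreover have "H = app_iso ?i G"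
    using f h by (simp add: app_iso_def bij_betw_def)
  ultimately show ?thesis
    unfolding digraph_iso_def by blast
qed

text \<open>
  If \<open>f\<close> encodes the points as words in such a way that each \<open>k\<close> acts by a shift letting the letter
  \<open>l x k\<close> in, then the arrow \<open>(x, k)\<close> is encoded as the word \<open>f x @ [l x k]\<close>.  For fixed \<open>x\<close> every
  letter must enter for exactly one \<open>k\<close>, whence no arrow is missed and none is doubled.
\<close>
lemma schreier_iso_de_bruijn:
  assumes "n > 0"
    and f: "bij_betw f X (words n S)"
    and l: "\<And>x. x \<in> X \<Longrightarrow> bij_betw (l x) K S"
    and closed: "\<And>x k. x \<in> X \<Longrightarrow> k \<in> K \<Longrightarrow> act x k \<in> X"
    and step: "\<And>x k. x \<in> X \<Longrightarrow> k \<in> K \<Longrightarrow> f (act x k) = tl (f x) @ [l x k]"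
  shows "digraph_iso (schreier_digraph X act K) (de_bruijn_digraph n S)"
proof (rule digraph_isoI)
  let ?G = "schreier_digraph X act K"
  let ?h = "\<lambda>(x, k). f x @ [l x k]"
  have f_words: "f x \<in> words n S" if "x \<in> X" for x
    using f that by (auto simp: bij_betw_def)
  have l_S: "l x k \<in> S" if "x \<in> X" "k \<in> K" for x k
    using l[OF that(1)] that(2) by (auto simp: bij_betw_def)
  show "wf_digraph ?G"
    using closed by unfold_locales (auto simp: schreier_digraph_def)
  show "bij_betw f (verts ?G) (verts (de_bruijn_digraph n S))"
    using f by (simp add: schreier_digraph_def de_bruijn_digraph_def)
  have inj: "inj_on ?h (X \<times> K)"
  proof (rule inj_onI, clarsimp)
    fix x k x' k'
    assume x: "x \<in> X" "x' \<in> X" and k: "k \<in> K" "k' \<in> K"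
      and eq: "f x = f x'" "l x k = l x' k'"
    have "x = x'"
      using f x eq(1) by (auto simp: bij_betw_def dest: inj_onD)
    then show "x = x' \<and> k = k'"
      using l[OF x(1)] k eq(2) by (auto simp: bij_betw_def dest: inj_onD)
  qed
  have "?h ` (X \<times> K) = words (n + 1) S"
  proof
    show "?h ` (X \<times> K) \<subseteq> words (n + 1) S"
      using f_words l_S unfolding words_def by (auto; blast)
    show "words (n + 1) S \<subseteq> ?h ` (X \<times> K)"
    proof
      fix w assume w: "w \<in> words (n + 1) S"
      then obtain u c where wu: "w = u @ [c]"
        by (cases w rule: rev_cases) (auto simp: words_def)
      then have "u \<in> words n S" "c \<in> S"
        using w by (auto simp: words_def)
      then obtain x where x: "x \<in> X" "u = f x"
        using f by (auto simp: bij_betw_def)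
      then obtain k where "k \<in> K" "c = l x k"
        using l[OF x(1)] \<open>c \<in> S\<close> by (auto simp: bij_betw_def)
      then show "w \<in> ?h ` (X \<times> K)"
        using x wu by auto
    qed
  qed
  with inj show "bij_betw ?h (arcs ?G) (arcs (de_bruijn_digraph n S))"
    by (simp add: bij_betw_def schreier_digraph_def de_bruijn_digraph_def)
  fix a assume "a \<in> arcs ?G"
  then obtain x k where a: "a = (x, k)" "x \<in> X" "k \<in> K"
    by (auto simp: schreier_digraph_def)
  show "tail (de_bruijn_digraph n S) (?h a) = f (tail ?G a)"
    using a by (simp add: schreier_digraph_def de_bruijn_digraph_def)
  have "f x \<noteq> []"
    using f_words[OF a(2)] \<open>n > 0\<close> by (auto simp: words_def)
  then show "head (de_bruijn_digraph n S) (?h a) = f (head ?G a)"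
    using a step by (simp add: schreier_digraph_def de_bruijn_digraph_def)
qed

section \<open>The wreath product with an abelian group\<close>

text \<open>
  Configurations are handled as elements of the group \<open>fun_group A B\<close>; unfolding them into
  extensional functions would hide the group laws from the simplifier.
\<close>
declare carrier_product_group [simp del] mult_product_group [simp del] one_product_group [simp del]

text \<open>
  The passage from \<open>T\<^sup>a T\<^sup>b\<close>, which is translation by \<open>b a\<close>, to \<open>T\<^sup>a\<^sup>b\<close> uses that \<open>A\<close> is abelian.
\<close>
locale abelian_wreath = A: comm_group A + B: group B
  for A :: "('a, 'm) monoid_scheme" and B :: "('b, 'n) monoid_scheme"
begin

abbreviation "F \<equiv> fun_group A B"
abbreviation "W \<equiv> wreath_product A B"
abbreviation "T \<equiv> translate A"

sublocale F: group F
  by (simp add: B.group_axioms)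

lemma config_apply_closed: "\<Phi> \<in> carrier F \<Longrightarrow> x \<in> carrier A \<Longrightarrow> \<Phi> x \<in> carrier B"
  by (auto simp: carrier_product_group)

lemma config_eqI:
  "\<lbrakk>\<Phi> \<in> carrier F; \<Psi> \<in> carrier F; \<And>x. x \<in> carrier A \<Longrightarrow> \<Phi> x = \<Psi> x\<rbrakk> \<Longrightarrow> \<Phi> = \<Psi>"
  unfolding carrier_product_group by (rule PiE_ext)

lemma mult_config_apply: "x \<in> carrier A \<Longrightarrow> (\<Phi> \<otimes>\<^bsub>F\<^esub> \<Psi>) x = \<Phi> x \<otimes>\<^bsub>B\<^esub> \<Psi> x"
  by (simp add: mult_product_group)

lemma translate_closed [simp]:
  assumes "a \<in> carrier A" "\<Phi> \<in> carrier F"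
  shows "T a \<Phi> \<in> carrier F"
  unfolding carrier_product_group translate_def
  using assms by (simp add: config_apply_closed)

lemma translate_apply: "x \<in> carrier A \<Longrightarrow> T a \<Phi> x = \<Phi> (x \<otimes>\<^bsub>A\<^esub> inv\<^bsub>A\<^esub> a)"
  by (simp add: translate_def)

lemma translate_one_left [simp]:
  assumes "\<Phi> \<in> carrier F"
  shows "T \<one>\<^bsub>A\<^esub> \<Phi> = \<Phi>"
  using assms by (intro config_eqI) (auto simp: translate_apply)

lemma translate_translate:
  assumes "a \<in> carrier A" "b \<in> carrier A" "\<Phi> \<in> carrier F"
  shows "T a (T b \<Phi>) = T (a \<otimes>\<^bsub>A\<^esub> b) \<Phi>"
  using assms
  by (intro config_eqI) (auto simp: translate_apply A.inv_mult A.m_assoc)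

lemma translate_mult:
  assumes "a \<in> carrier A" "\<Phi> \<in> carrier F" "\<Psi> \<in> carrier F"
  shows "T a (\<Phi> \<otimes>\<^bsub>F\<^esub> \<Psi>) = T a \<Phi> \<otimes>\<^bsub>F\<^esub> T a \<Psi>"
  using assms by (intro config_eqI) (auto simp: translate_apply mult_config_apply)

lemma translate_one_config [simp]:
  assumes "a \<in> carrier A"
  shows "T a \<one>\<^bsub>F\<^esub> = \<one>\<^bsub>F\<^esub>"
  using assms by (intro config_eqI translate_closed F.one_closed) (auto simp: translate_apply one_product_group)

lemma carrier_wreath: "carrier W = carrier A \<times> carrier F"
  and mult_wreath: "(a, \<Phi>) \<otimes>\<^bsub>W\<^esub> (b, \<Psi>) = (a \<otimes>\<^bsub>A\<^esub> b, \<Phi> \<otimes>\<^bsub>F\<^esub> T a \<Psi>)"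
  and one_wreath: "\<one>\<^bsub>W\<^esub> = (\<one>\<^bsub>A\<^esub>, \<one>\<^bsub>F\<^esub>)"
  by (simp_all add: wreath_product_def)

lemma group_wreath: "group W"
proof (rule groupI)
  show "x \<otimes>\<^bsub>W\<^esub> y \<in> carrier W" if "x \<in> carrier W" "y \<in> carrier W" for x y
    using that by (cases x; cases y) (simp add: carrier_wreath mult_wreath)
  show "\<one>\<^bsub>W\<^esub> \<in> carrier W"
    by (simp add: carrier_wreath one_wreath)
  show "x \<otimes>\<^bsub>W\<^esub> y \<otimes>\<^bsub>W\<^esub> z = x \<otimes>\<^bsub>W\<^esub> (y \<otimes>\<^bsub>W\<^esub> z)"
    if "x \<in> carrier W" "y \<in> carrier W" "z \<in> carrier W" for x y z
    using that
    by (cases x; cases y; cases z)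
      (simp add: carrier_wreath mult_wreath A.m_assoc F.m_assoc translate_mult translate_translate)
  show "\<one>\<^bsub>W\<^esub> \<otimes>\<^bsub>W\<^esub> x = x" if "x \<in> carrier W" for x
    using that by (cases x) (simp add: carrier_wreath mult_wreath one_wreath)
  show "\<exists>y\<in>carrier W. y \<otimes>\<^bsub>W\<^esub> x = \<one>\<^bsub>W\<^esub>" if "x \<in> carrier W" for x
  proof (cases x)
    case (Pair a \<Phi>)
    then have "a \<in> carrier A" "\<Phi> \<in> carrier F"
      using that by (simp_all add: carrier_wreath)
    then show ?thesis
      unfolding Pair
      by (intro bexI[of _ "(inv\<^bsub>A\<^esub> a, inv\<^bsub>F\<^esub> (T (inv\<^bsub>A\<^esub> a) \<Phi>))"])
        (simp_all add: carrier_wreath mult_wreath one_wreath del: inv_product_group)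
  qed
qed

sublocale W: group W
  by (rule group_wreath)

abbreviation "H \<equiv> embedded_active A B"

lemma embedded_mult:
  "\<lbrakk>c \<in> carrier A; a \<in> carrier A; \<Phi> \<in> carrier F\<rbrakk>
    \<Longrightarrow> (c, \<one>\<^bsub>F\<^esub>) \<otimes>\<^bsub>W\<^esub> (a, \<Phi>) = (c \<otimes>\<^bsub>A\<^esub> a, T c \<Phi>)"
  by (simp add: mult_wreath)

lemma subgroup_embedded: "subgroup H W"
proof (rule W.subgroupI)
  show "H \<subseteq> carrier W"
    by (auto simp: embedded_active_def carrier_wreath)
  show "H \<noteq> {}"
    by (auto simp: embedded_active_def)
  show "inv\<^bsub>W\<^esub> x \<in> H" if x: "x \<in> H" for x
  proof -
    obtain a where a: "a \<in> carrier A" "x = (a, \<one>\<^bsub>F\<^esub>)"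
      using x by (auto simp: embedded_active_def)
    have "inv\<^bsub>W\<^esub> x = (inv\<^bsub>A\<^esub> a, \<one>\<^bsub>F\<^esub>)"
      using a by (intro W.inv_equality) (simp_all add: carrier_wreath mult_wreath one_wreath)
    then show ?thesis
      using a by (auto simp: embedded_active_def)
  qed
  show "x \<otimes>\<^bsub>W\<^esub> y \<in> H" if "x \<in> H" "y \<in> H" for x y
    using that by (auto simp: embedded_active_def embedded_mult)
qed

lemma coset_config_rcoset:
  assumes "a \<in> carrier A" "\<Phi> \<in> carrier F"
  shows "coset_config A (H #>\<^bsub>W\<^esub> (a, \<Phi>)) = T (inv\<^bsub>A\<^esub> a) \<Phi>"
proof -
  have "H #>\<^bsub>W\<^esub> (a, \<Phi>) = (\<lambda>c. (c \<otimes>\<^bsub>A\<^esub> a, T c \<Phi>)) ` carrier A"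
    using assms by (auto simp: r_coset_def embedded_active_def embedded_mult)
  (* T^-(ca) T^c = T^-a, so the map is constant on the coset *)
  moreover have "T (inv\<^bsub>A\<^esub> (c \<otimes>\<^bsub>A\<^esub> a)) (T c \<Phi>) = T (inv\<^bsub>A\<^esub> a) \<Phi>" if "c \<in> carrier A" for c
  proof -
    have "inv\<^bsub>A\<^esub> (c \<otimes>\<^bsub>A\<^esub> a) \<otimes>\<^bsub>A\<^esub> c = inv\<^bsub>A\<^esub> a"
      using assms that by (simp add: A.inv_mult_group A.m_assoc)
    then show ?thesis
      using assms that by (simp add: translate_translate)
  qed
  ultimately have "(\<lambda>(a, \<Phi>). T (inv\<^bsub>A\<^esub> a) \<Phi>) ` (H #>\<^bsub>W\<^esub> (a, \<Phi>)) = {T (inv\<^bsub>A\<^esub> a) \<Phi>}"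
    by (auto simp: image_image intro!: image_eqI[of _ _ "\<one>\<^bsub>A\<^esub>"])
  then show ?thesis
    by (simp add: coset_config_def)
qed

text \<open>The factorisation \<open>(a, \<Phi>) = (a, \<emptyset>) \<cdot> (1, T\<^sup>-\<^sup>a \<Phi>)\<close>, read modulo \<open>A\<close>.\<close>
lemma rcoset_trivial_rep:
  assumes "a \<in> carrier A" "\<Phi> \<in> carrier F"
  shows "H #>\<^bsub>W\<^esub> (a, \<Phi>) = H #>\<^bsub>W\<^esub> (\<one>\<^bsub>A\<^esub>, T (inv\<^bsub>A\<^esub> a) \<Phi>)"
proof (rule W.repr_independence[OF _ _ subgroup_embedded])
  show "(\<one>\<^bsub>A\<^esub>, T (inv\<^bsub>A\<^esub> a) \<Phi>) \<in> H #>\<^bsub>W\<^esub> (a, \<Phi>)"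
    unfolding r_coset_def embedded_active_def
    using assms by (auto simp: embedded_mult intro!: exI[of _ "inv\<^bsub>A\<^esub> a"])
  show "(a, \<Phi>) \<in> carrier W"
    using assms by (simp add: carrier_wreath)
qed

lemma rcosets_trivial_rep:
  assumes "C \<in> coset_space A B"
  shows "coset_config A C \<in> carrier F" "C = H #>\<^bsub>W\<^esub> (\<one>\<^bsub>A\<^esub>, coset_config A C)"
proof -
  obtain a \<Phi> where a: "a \<in> carrier A" "\<Phi> \<in> carrier F" and C: "C = H #>\<^bsub>W\<^esub> (a, \<Phi>)"
    using assms by (auto simp: coset_space_def RCOSETS_def carrier_wreath)
  have "coset_config A C = T (inv\<^bsub>A\<^esub> a) \<Phi>"
    unfolding C using a by (rule coset_config_rcoset)
  then show "coset_config A C \<in> carrier F" "C = H #>\<^bsub>W\<^esub> (\<one>\<^bsub>A\<^esub>, coset_config A C)"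
    using a rcoset_trivial_rep[OF a] C by simp_all
qed

lemma bij_betw_coset_config: "bij_betw (coset_config A) (coset_space A B) (carrier F)"
proof (rule bij_betwI)
  let ?coset = "\<lambda>\<Psi>. H #>\<^bsub>W\<^esub> (\<one>\<^bsub>A\<^esub>, \<Psi>)"
  show "coset_config A \<in> coset_space A B \<rightarrow> carrier F"
    using rcosets_trivial_rep(1) by blast
  show "?coset \<in> carrier F \<rightarrow> coset_space A B"
    unfolding coset_space_def
    by (auto simp: carrier_wreath intro!: W.rcosetsI subgroup.subset[OF subgroup_embedded])
  show "?coset (coset_config A C) = C" if "C \<in> coset_space A B" for C
    using rcosets_trivial_rep(2)[OF that] by simp
  show "coset_config A (?coset \<Psi>) = \<Psi>" if "\<Psi> \<in> carrier F" for \<Psi>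
    using that by (simp add: coset_config_rcoset)
qed

text \<open>On representatives with trivial \<open>A\<close>-component, \<open>(1, \<Psi>) \<cdot> (a, \<Phi>) = (a, \<Psi> \<cdot> \<Phi>)\<close>.\<close>
lemma coset_config_equivariant:
  assumes C: "C \<in> coset_space A B" and x: "x \<in> carrier W"
  shows "coset_config A (C #>\<^bsub>W\<^esub> x) = config_action A B (coset_config A C) x"
proof -
  obtain a \<Phi> where x': "x = (a, \<Phi>)" "a \<in> carrier A" "\<Phi> \<in> carrier F"
    using x by (auto simp: carrier_wreath)
  define \<Psi> where "\<Psi> = coset_config A C"
  have \<Psi>: "\<Psi> \<in> carrier F" "C = H #>\<^bsub>W\<^esub> (\<one>\<^bsub>A\<^esub>, \<Psi>)"
    using rcosets_trivial_rep[OF C] by (simp_all add: \<Psi>_def)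
  have "C #>\<^bsub>W\<^esub> x = H #>\<^bsub>W\<^esub> ((\<one>\<^bsub>A\<^esub>, \<Psi>) \<otimes>\<^bsub>W\<^esub> x)"
    unfolding \<Psi>(2)
    using \<Psi>(1) x by (intro W.coset_mult_assoc subgroup.subset[OF subgroup_embedded])
      (simp_all add: carrier_wreath)
  also have "\<dots> = H #>\<^bsub>W\<^esub> (a, \<Psi> \<otimes>\<^bsub>F\<^esub> \<Phi>)"
    using x' \<Psi>(1) by (simp add: mult_wreath)
  finally have "coset_config A (C #>\<^bsub>W\<^esub> x) = T (inv\<^bsub>A\<^esub> a) (\<Psi> \<otimes>\<^bsub>F\<^esub> \<Phi>)"
    using x' \<Psi>(1) by (simp add: coset_config_rcoset)
  then show ?thesis
    by (simp add: x'(1) config_action_def \<Psi>_def)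
qed

lemma right_group_action_coset_space:
  "right_group_action W (coset_space A B) (\<lambda>C x. C #>\<^bsub>W\<^esub> x)"
  unfolding coset_space_def by (rule W.right_group_action_rcosets[OF subgroup_embedded])

lemma right_group_action_config: "right_group_action W (carrier F) (config_action A B)"
  using right_group_action_coset_space bij_betw_coset_config coset_config_equivariant
  by (rule right_group_action.right_group_action_transport)

lemma delta_closed:
  assumes "b \<in> carrier B"
  shows "delta A B a b \<in> carrier F"
  using assms by (simp add: delta_def carrier_product_group)

end

section \<open>A cyclic group acting by shifts\<close>

lemma bij_betw_pow_generator:
  assumes "group A" "finite (carrier A)" "g \<in> carrier A" "subgroup_generated A {g} = A"
  shows "bij_betw (\<lambda>i::nat. g [^]\<^bsub>A\<^esub> i) {1..<order A + 1} (carrier A)"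
proof -
  interpret A: group A by fact
  have "A.ord g = order A"
    using A.cyclic_order_is_ord[OF assms(3)] assms(4) by simp
  then have inj: "inj_on (\<lambda>i::nat. g [^]\<^bsub>A\<^esub> i) {1..<order A + 1}"
    using A.ord_inj'[OF assms(3)] by (simp add: atLeastLessThanSuc_atLeastAtMost)
  moreover have "(\<lambda>i::nat. g [^]\<^bsub>A\<^esub> i) ` {1..<order A + 1} = carrier A"
  proof (rule card_subset_eq[OF assms(2)])
    show "(\<lambda>i::nat. g [^]\<^bsub>A\<^esub> i) ` {1..<order A + 1} \<subseteq> carrier A"
      using assms(3) by auto
    show "card ((\<lambda>i::nat. g [^]\<^bsub>A\<^esub> i) ` {1..<order A + 1}) = card (carrier A)"
      using card_image[OF inj] by (simp add: order_def)
  qed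
  ultimately show ?thesis
    by (simp add: bij_betw_def)
qed

locale cyclic_wreath = abelian_wreath A B
  for A :: "'a monoid" and B :: "('b, 'n) monoid_scheme" +
  fixes g :: 'a
  assumes finite_A: "finite (carrier A)"
    and generator: "g \<in> carrier A" "subgroup_generated A {g} = A"
begin

abbreviation "n \<equiv> order A"

lemma n_pos: "n > 0"
  by (simp add: A.order_gt_0_iff_finite finite_A)

lemma bij_betw_config_word: "bij_betw (config_word A g) (carrier F) (words n (carrier B))"
  using bij_betw_PiE_words[OF bij_betw_pow_generator[OF A.is_group finite_A generator]]
  unfolding config_word_def[abs_def] carrier_product_group .

text \<open>
  The configuration \<open>T\<^sup>-\<^sup>g (\<Psi> \<cdot> \<delta>\<^sub>g\<^sup>b)\<close> has at \<open>g\<^sup>i\<close> the value of \<open>\<Psi> \<cdot> \<delta>\<^sub>g\<^sup>b\<close> at \<open>g\<^sup>i\<^sup>+\<^sup>1\<close>, so the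
  multiplied letter, which stood first, now stands last: \<open>g\<^sup>n\<^sup>+\<^sup>1 = g\<close>.
\<close>
lemma config_word_step:
  assumes \<Psi>: "\<Psi> \<in> carrier F" and b: "b \<in> carrier B"
  shows "config_word A g (config_action A B \<Psi> (g, delta A B g b)) =
    tl (config_word A g \<Psi>) @ [\<Psi> g \<otimes>\<^bsub>B\<^esub> b]"
proof -
  let ?\<Psi>' = "config_action A B \<Psi> (g, delta A B g b)"
  have val: "?\<Psi>' (g [^]\<^bsub>A\<^esub> i) = \<Psi> (g [^]\<^bsub>A\<^esub> Suc i) \<otimes>\<^bsub>B\<^esub> (if g [^]\<^bsub>A\<^esub> Suc i = g then b else \<one>\<^bsub>B\<^esub>)"
    for i :: nat
    using generator(1)
    by (simp add: config_action_def translate_apply mult_config_apply delta_def)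
  have inj: "inj_on (\<lambda>i::nat. g [^]\<^bsub>A\<^esub> i) {1..<n + 1}"
    using bij_betw_pow_generator[OF A.is_group finite_A generator] by (simp add: bij_betw_def)
  have "?\<Psi>' (g [^]\<^bsub>A\<^esub> i) = \<Psi> (g [^]\<^bsub>A\<^esub> Suc i)" if "i \<in> {1..<n}" for i
  proof -
    have "g [^]\<^bsub>A\<^esub> Suc i \<noteq> g [^]\<^bsub>A\<^esub> (1::nat)"
      using inj_on_eq_iff[OF inj, of "Suc i" 1] that by simp
    then have "g [^]\<^bsub>A\<^esub> Suc i \<noteq> g"
      using generator(1) by simp
    then show ?thesis
      using config_apply_closed[OF \<Psi>, of "g [^]\<^bsub>A\<^esub> Suc i"] generator(1)
      unfolding val by simp
  qed
  then have init: "map (\<lambda>i. ?\<Psi>' (g [^]\<^bsub>A\<^esub> i)) [1..<n] = map (\<lambda>i. \<Psi> (g [^]\<^bsub>A\<^esub> Suc i)) [1..<n]"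
    by (intro map_cong) simp_all
  have "g [^]\<^bsub>A\<^esub> n = \<one>\<^bsub>A\<^esub>"
    using A.pow_order_eq_1 generator(1) by simp
  then have last: "?\<Psi>' (g [^]\<^bsub>A\<^esub> n) = \<Psi> g \<otimes>\<^bsub>B\<^esub> b"
    unfolding val using generator(1) by simp
  have "config_word A g ?\<Psi>' = map (\<lambda>i. ?\<Psi>' (g [^]\<^bsub>A\<^esub> i)) [1..<n] @ [?\<Psi>' (g [^]\<^bsub>A\<^esub> n)]"
    using n_pos by (simp add: config_word_def)
  also have "map (\<lambda>i. ?\<Psi>' (g [^]\<^bsub>A\<^esub> i)) [1..<n] = map (\<lambda>i. \<Psi> (g [^]\<^bsub>A\<^esub> i)) (map Suc [1..<n])"
    using init by (simp add: comp_def)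
  also have "map Suc [1..<n] = tl [1..<n + 1]"
    using n_pos by (simp add: map_Suc_upt upt_rec[of 1] del: upt_Suc)
  finally show ?thesis
    unfolding last map_tl config_word_def .
qed

lemma B_plus_closed: "B_plus A B g \<subseteq> carrier W"
  using generator(1) delta_closed by (auto simp: B_plus_def carrier_wreath)

lemma bij_betw_new_letter:
  assumes "c \<in> carrier B"
  shows "bij_betw (\<lambda>k. c \<otimes>\<^bsub>B\<^esub> snd k g) (B_plus A B g) (carrier B)"
proof (rule bij_betwI[where g = "\<lambda>d. (g, delta A B g (inv\<^bsub>B\<^esub> c \<otimes>\<^bsub>B\<^esub> d))"])
  have delta_g: "delta A B g b g = b" for b
    using generator(1) by (simp add: delta_def)
  show "(\<lambda>k. c \<otimes>\<^bsub>B\<^esub> snd k g) \<in> B_plus A B g \<rightarrow> carrier B"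
    using assms by (auto simp: B_plus_def delta_g)
  show "(\<lambda>d. (g, delta A B g (inv\<^bsub>B\<^esub> c \<otimes>\<^bsub>B\<^esub> d))) \<in> carrier B \<rightarrow> B_plus A B g"
    using assms by (auto simp: B_plus_def)
  show "(g, delta A B g (inv\<^bsub>B\<^esub> c \<otimes>\<^bsub>B\<^esub> (c \<otimes>\<^bsub>B\<^esub> snd k g))) = k" if "k \<in> B_plus A B g" for k
    using that assms by (auto simp: B_plus_def delta_g B.inv_solve_left simp flip: B.m_assoc)
  show "c \<otimes>\<^bsub>B\<^esub> snd (g, delta A B g (inv\<^bsub>B\<^esub> c \<otimes>\<^bsub>B\<^esub> d)) g = d" if "d \<in> carrier B" for d
    using that assms by (simp add: delta_g flip: B.m_assoc)
qed

text \<open>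
  Any space with an equivariant bijection onto the configurations qualifies: both the coset space
  and the configuration space itself are of this kind.
\<close>
lemma schreier_iso_de_bruijn_config:
  assumes "right_group_action W X act"
    and f: "bij_betw f X (carrier F)"
    and equivariant: "\<And>x k. x \<in> X \<Longrightarrow> k \<in> carrier W \<Longrightarrow> f (act x k) = config_action A B (f x) k"
  shows "digraph_iso (schreier_digraph X act (B_plus A B g)) (de_bruijn_digraph n (carrier B))"
proof (rule schreier_iso_de_bruijn)
  interpret right_group_action W X act by fact
  have fx: "f x \<in> carrier F" if "x \<in> X" for x
    using f that by (auto simp: bij_betw_def)
  show "n > 0"
    by (rule n_pos)
  show "bij_betw (config_word A g \<circ> f) X (words n (carrier B))"
    using f bij_betw_config_word by (rule bij_betw_trans)
  show "bij_betw (\<lambda>k. f x g \<otimes>\<^bsub>B\<^esub> snd k g) (B_plus A B g) (carrier B)" if "x \<in> X" for x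
    using config_apply_closed[OF fx[OF that] generator(1)] by (rule bij_betw_new_letter)
  fix x k assume x: "x \<in> X" and k: "k \<in> B_plus A B g"
  then have kW: "k \<in> carrier W"
    using B_plus_closed by blast
  with x show "act x k \<in> X"
    by (rule act_closed)
  obtain b where "b \<in> carrier B" "k = (g, delta A B g b)"
    using k by (auto simp: B_plus_def)
  then show "(config_word A g \<circ> f) (act x k) =
      tl ((config_word A g \<circ> f) x) @ [f x g \<otimes>\<^bsub>B\<^esub> snd k g]"
    using equivariant[OF x kW] config_word_step[OF fx[OF x]] generator(1)
    by (simp add: delta_def)
qed

end

theorem theorem7p7:
  fixes A :: "'a monoid" and B :: "('b, 'n) monoid_scheme" and g :: 'a
  assumes "group A" and "finite (carrier A)"
    and "g \<in> carrier A" and "subgroup_generated A {g} = A"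
    and "group B"
  defines "G \<equiv> wreath_product A B"
  shows "subgroup (embedded_active A B) G \<and>
     right_group_action G (coset_space A B) (\<lambda>C x. C #>\<^bsub>G\<^esub> x) \<and>
     (\<forall>a\<in>carrier A. \<forall>\<Phi>\<in>carrier (fun_group A B).
           coset_config A (embedded_active A B #>\<^bsub>G\<^esub> (a, \<Phi>)) = translate A (inv\<^bsub>A\<^esub> a) \<Phi>) \<and>
     bij_betw (coset_config A) (coset_space A B) (carrier (fun_group A B)) \<and>
     bij_betw (config_word A g) (carrier (fun_group A B)) (words (order A) (carrier B)) \<and>
     right_group_action G (carrier (fun_group A B)) (config_action A B) \<and>
     (\<forall>C\<in>coset_space A B. \<forall>x\<in>carrier G.
           coset_config A (C #>\<^bsub>G\<^esub> x) = config_action A B (coset_config A C) x) \<and>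
     digraph_iso
           (schreier_digraph (coset_space A B) (\<lambda>C x. C #>\<^bsub>G\<^esub> x) (B_plus A B g))
           (de_bruijn_digraph (order A) (carrier B)) \<and>
     digraph_iso
           (schreier_digraph (carrier (fun_group A B)) (config_action A B) (B_plus A B g))
           (de_bruijn_digraph (order A) (carrier B))"
proof -
  interpret A: group A by fact
  interpret A: comm_group A
    using assms(3,4) by (intro A.cyclic_imp_abelian_group) (auto simp: cyclic_group_def)
  interpret B: group B by fact
  interpret cyclic_wreath A B g
    using assms by unfold_locales
  show ?thesis
    unfolding G_def
  proof (intro conjI ballI)
    show "digraph_iso
        (schreier_digraph (coset_space A B) (\<lambda>C x. C #>\<^bsub>W\<^esub> x) (B_plus A B g))
        (de_bruijn_digraph (order A) (carrier B))"
      using right_group_action_coset_space bij_betw_coset_config coset_config_equivariant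
      by (rule schreier_iso_de_bruijn_config)
    show "digraph_iso
        (schreier_digraph (carrier F) (config_action A B) (B_plus A B g))
        (de_bruijn_digraph (order A) (carrier B))"
      using right_group_action_config bij_betw_id[of "carrier F"]
      by (rule schreier_iso_de_bruijn_config) simp
  qed (rule subgroup_embedded right_group_action_coset_space coset_config_rcoset
      bij_betw_coset_config bij_betw_config_word right_group_action_config
      coset_config_equivariant; assumption)+
qed

end
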